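(* Let $n\ge 2$ and $d\ge 1$ be integers, let $\mathrm T,\mathfrak t\in\mathbb{C}^n\otimes((\mathbb{C}^n)^\ast)^{\otimes d}$ be two tensors with $\operatorname{Res}(\mathfrak t)\neq 0$, and let $\lambda\in\mathbb{C}$. Then $$\operatorname{am}_{\mathrm T,\mathfrak t}(\lambda)\ \ge\ \operatorname{sm}_{\mathrm T,\mathfrak t}(\lambda).$$
   Context: Macaulay's resultant $\operatorname{Res}$ is the irreducible polynomial in the coefficients of $n$ homogeneous polynomials $f_1,\dots,f_n$ of degree $d$ in $\mathbb{C}[x_1,\dots,x_n]$, unique up to a nonzero constant, such that $\operatorname{Res}(f_1,\dots,f_n)=0$ if and only if $f_1,\dots,f_n$ have a common zero in $\mathbb{P}^{n-1}$. A tensor $\mathrm T\in\mathbb{C}^n\otimes((\mathbb{C}^n)^\ast)^{\otimes d}$ is viewed as a linear map $(\mathbb{C}^n)^{\otimes d}\to\mathbb{C}^n$ and induces a polynomial map $\mathbb{C}^n\to\mathbb{C}^n$, $\mathrm T(\omega)=\mathrm T(\omega^{\otimes d})=(f_1(\omega),\dots,f_n(\omega))$ with each $f_i$ homogeneous of degree $d$ (or zero); set $\operatorname{Res}(\mathrm T)=\operatorname{Res}(f_1,\dots,f_n)$. For $\lambda\in\mathbb{C}$, the eigenscheme $E_{\mathrm T,\mathfrak t}(\lambda)\subset\mathbb{C}^n$ is the affine scheme defined by the equations $\mathrm T(\omega)=\lambda\,\mathfrak t(\omega)$; the set underlying its reduced scheme is $E_{\mathrm T,\mathfrak t}(\lambda)_{\mathrm{red}}=\{\omega\in\mathbb{C}^n\mid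 (\mathrm T-\lambda\mathfrak t)(\omega)=0\}$. The span multiplicity is $\operatorname{sm}_{\mathrm T,\mathfrak t}(\lambda)=\dim\operatorname{span}_{\mathbb{C}}(E_{\mathrm T,\mathfrak t}(\lambda)_{\mathrm{red}})$. The $\mathfrak t$-characteristic polynomial of $\mathrm T$ is $p_{\mathrm T,\mathfrak t}(s)=\operatorname{Res}(\mathrm T-s\,\mathfrak t)$, and the algebraic multiplicity $\operatorname{am}_{\mathrm T,\mathfrak t}(\lambda)$ is the order of vanishing of $p_{\mathrm T,\mathfrak t}(s)$ at $s=\lambda$ (which is $0$ if $p_{\mathrm T,\mathfrak t}(\lambda)\ne 0$). *)

theory Defs
  imports
    "HOL-Analysis.Analysis"
    "HOL-Library.Poly_Mapping"
    "HOL-Computational_Algebra.Polynomial"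
begin

section \<open>Multivariate polynomials\<close>

text \<open>
  The polynomial ring over \<open>'a\<close> in the variables \<open>'v\<close> is the monoid algebra of the exponent
  vectors \<open>'v \<Rightarrow>\<^sub>0 nat\<close>, with the ring structure of \<^theory>\<open>HOL-Library.Poly_Mapping\<close>.
\<close>

type_synonym 'v exponent = "'v \<Rightarrow>\<^sub>0 nat"
type_synonym ('v, 'a) mpoly = "'v exponent \<Rightarrow>\<^sub>0 'a"

definition mdegree :: "'v exponent \<Rightarrow> nat" where
  "mdegree m = (\<Sum>x\<in>Poly_Mapping.keys m. Poly_Mapping.lookup m x)"

definition monom_value :: "('v \<Rightarrow> 'b::comm_ring_1) \<Rightarrow> 'v exponent \<Rightarrow> 'b" where
  "monom_value v m = (\<Prod>x\<in>Poly_Mapping.keys m. v x ^ Poly_Mapping.lookup m x)"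

text \<open>
  The value of \<open>p\<close> at the point \<open>v\<close> of a ring \<open>'b\<close>, where the coefficients of \<open>p\<close> are sent
  to \<open>'b\<close> by \<open>h\<close>.
\<close>

definition mpoly_eval :: "('a::comm_ring_1 \<Rightarrow> 'b::comm_ring_1) \<Rightarrow> ('v \<Rightarrow> 'b) \<Rightarrow> ('v, 'a) mpoly \<Rightarrow> 'b" where
  "mpoly_eval h v p = (\<Sum>m\<in>Poly_Mapping.keys p. h (Poly_Mapping.lookup p m) * monom_value v m)"

text \<open>The zero polynomial is homogeneous of every degree.\<close>

definition homogeneous :: "nat \<Rightarrow> ('v, 'a::comm_ring_1) mpoly \<Rightarrow> bool" where
  "homogeneous d p \<longleftrightarrow> (\<forall>m\<in>Poly_Mapping.keys p. mdegree m = d)"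


section \<open>Macaulay's resultant\<close>

text \<open>
  The variable \<open>(i, m)\<close> stands for the coefficient of the monomial \<open>m\<close> in the \<open>i\<close>-th form.
  The type of exponents \<open>m\<close> is not restricted to total degree \<open>d\<close>; instead, the resultant for
  degree \<open>d\<close> is required to involve only variables with \<open>mdegree m = d\<close>. A factor of a polynomial
  in these variables involves no further variables, so irreducibility means the same in both rings.
\<close>

type_synonym 'n coeff_poly = "('n \<times> 'n exponent, complex) mpoly"

definition resultant_value ::
  "(complex \<Rightarrow> 'b::comm_ring_1) \<Rightarrow> 'n coeff_poly \<Rightarrow> ('n \<Rightarrow> ('n, 'b) mpoly) \<Rightarrow> 'b" where
  "resultant_value h R f = mpoly_eval h (\<lambda>(i, m). Poly_Mapping.lookup (f i) m) R"

text \<open>A common zero in projective space is given by a nonzero vector of homogeneous coordinates.\<close>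

definition has_projective_zero :: "('n::finite \<Rightarrow> ('n, complex) mpoly) \<Rightarrow> bool" where
  "has_projective_zero f \<longleftrightarrow> (\<exists>x::complex^'n. x \<noteq> 0 \<and> (\<forall>i. mpoly_eval id (($) x) (f i) = 0))"

text \<open>
  Macaulay's resultant is only determined up to a nonzero constant factor, so it is given by its
  defining property instead of as a fixed polynomial.
\<close>

definition macaulay_resultant :: "nat \<Rightarrow> ('n::finite) coeff_poly \<Rightarrow> bool" where
  "macaulay_resultant d R \<longleftrightarrow>
     irreducible R \<and>
     (\<forall>M\<in>Poly_Mapping.keys R. \<forall>(i, m)\<in>Poly_Mapping.keys M. mdegree m = d) \<and>
     (\<forall>f. (\<forall>i. homogeneous d (f i)) \<longrightarrow> (resultant_value id R f = 0 \<longleftrightarrow> has_projective_zero f))"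


section \<open>Tensors\<close>

text \<open>
  An element of \<open>K\<^sup>n \<otimes> ((K\<^sup>n)\<^sup>*)\<^sup>\<otimes>\<^sup>d\<close> is given by its coordinates \<open>T $ (i, J)\<close> in the standard
  basis, where \<open>n = CARD('n)\<close> and \<open>d = CARD('d)\<close>: the index \<open>i\<close> belongs to the factor \<open>K\<^sup>n\<close> and
  \<open>J k\<close> to the \<open>k\<close>-th dual factor. As types are nonempty, \<open>d \<ge> 1\<close>.
\<close>

type_synonym ('a, 'n, 'd) tensor = "'a ^ ('n \<times> ('d \<Rightarrow> 'n))"

definition tensor_map ::
  "('a::comm_ring_1, 'n::finite, 'd::finite) tensor \<Rightarrow> 'a ^ 'n \<Rightarrow> 'a ^ 'n" where
  "tensor_map T w = (\<chi> i. \<Sum>J\<in>UNIV. T $ (i, J) * (\<Prod>k\<in>UNIV. w $ J k))"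

text \<open>The polynomials \<open>f\<^sub>1, \<dots>, f\<^sub>n\<close> with \<open>T(\<omega>) = (f\<^sub>1(\<omega>), \<dots>, f\<^sub>n(\<omega>))\<close>.\<close>

definition tensor_forms ::
  "('a::comm_ring_1, 'n::finite, 'd::finite) tensor \<Rightarrow> 'n \<Rightarrow> ('n, 'a) mpoly" where
  "tensor_forms T i =
     (\<Sum>J\<in>UNIV. Poly_Mapping.single (\<Sum>k\<in>UNIV. Poly_Mapping.single (J k) 1) (T $ (i, J)))"

definition tensor_resultant ::
  "('n::finite) coeff_poly \<Rightarrow> (complex, 'n, 'd::finite) tensor \<Rightarrow> complex" where
  "tensor_resultant R T = resultant_value id R (tensor_forms T)"

definition eigenset ::
  "(complex, 'n::finite, 'd::finite) tensor \<Rightarrow> (complex, 'n, 'd) tensor \<Rightarrow> complex \<Rightarrow> (complex ^ 'n) set" where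
  "eigenset T t l = {w. tensor_map (T - l *s t) w = 0}"

text \<open>The dimension is over the complex numbers (\<^const>\<open>dim\<close> would be the real dimension).\<close>

definition span_multiplicity ::
  "(complex, 'n::finite, 'd::finite) tensor \<Rightarrow> (complex, 'n, 'd) tensor \<Rightarrow> complex \<Rightarrow> nat" where
  "span_multiplicity T t l = vec.dim (vec.span (eigenset T t l))"

definition const_tensor ::
  "('a::comm_ring_1, 'n::finite, 'd::finite) tensor \<Rightarrow> ('a poly, 'n, 'd) tensor" where
  "const_tensor T = (\<chi> I. [:T $ I:])"

text \<open>
  The resultant of the tensor \<open>T - s t\<close> with entries in \<open>\<complex>[s]\<close>; the variable \<open>s\<close> is \<open>[:0, 1:]\<close>.
\<close>

definition char_poly ::
  "('n::finite) coeff_poly \<Rightarrow> (complex, 'n, 'd::finite) tensor \<Rightarrow> (complex, 'n, 'd) tensor \<Rightarrow> complex poly" where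
  "char_poly R T t =
     resultant_value (\<lambda>c. [:c:]) R (tensor_forms (const_tensor T - [:0, 1:] *s const_tensor t))"

definition alg_multiplicity ::
  "('n::finite) coeff_poly \<Rightarrow> (complex, 'n, 'd::finite) tensor \<Rightarrow> (complex, 'n, 'd) tensor \<Rightarrow> complex \<Rightarrow> nat" where
  "alg_multiplicity R T t l = order l (char_poly R T t)"


section \<open>Compatibility of the definitions\<close>

lemma mdegree_superset:
  assumes "finite A" "Poly_Mapping.keys m \<subseteq> A"
  shows "mdegree m = (\<Sum>x\<in>A. Poly_Mapping.lookup m x)"
  unfolding mdegree_def using assms by (intro sum.mono_neutral_left) (auto simp: in_keys_iff)

lemma monom_value_superset:
  assumes "finite A" "Poly_Mapping.keys m \<subseteq> A"
  shows "monom_value v m = (\<Prod>x\<in>A. v x ^ Poly_Mapping.lookup m x)"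
  unfolding monom_value_def using assms by (intro prod.mono_neutral_left) (auto simp: in_keys_iff)

lemma mpoly_eval_superset:
  assumes "finite A" "Poly_Mapping.keys p \<subseteq> A" "h 0 = 0"
  shows "mpoly_eval h v p = (\<Sum>m\<in>A. h (Poly_Mapping.lookup p m) * monom_value v m)"
  unfolding mpoly_eval_def using assms by (intro sum.mono_neutral_left) (auto simp: in_keys_iff)

lemma mdegree_add: "mdegree (a + b) = mdegree a + mdegree b"
proof -
  let ?A = "Poly_Mapping.keys a \<union> Poly_Mapping.keys b"
  have "Poly_Mapping.keys (a + b) \<subseteq> ?A" by (rule Poly_Mapping.keys_add)
  then show ?thesis
    by (simp add: mdegree_superset[of ?A] lookup_add sum.distrib)
qed

lemma monom_value_add: "monom_value v (a + b) = monom_value v a * monom_value v b"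
proof -
  let ?A = "Poly_Mapping.keys a \<union> Poly_Mapping.keys b"
  have "Poly_Mapping.keys (a + b) \<subseteq> ?A" by (rule Poly_Mapping.keys_add)
  then show ?thesis
    by (simp add: monom_value_superset[of ?A] lookup_add prod.distrib power_add)
qed

lemma mdegree_index:
  "finite K \<Longrightarrow> mdegree (\<Sum>k\<in>K. Poly_Mapping.single (J k) 1) = card K"
  by (induction K rule: finite_induct) (simp_all add: mdegree_add, simp_all add: mdegree_def)

lemma monom_value_index:
  "finite K \<Longrightarrow> monom_value v (\<Sum>k\<in>K. Poly_Mapping.single (J k) 1) = (\<Prod>k\<in>K. v (J k))"
  by (induction K rule: finite_induct) (simp_all add: monom_value_add, simp_all add: monom_value_def)

lemma mpoly_eval_id_add: "mpoly_eval id v (p + q) = mpoly_eval id v p + mpoly_eval id v q"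
proof -
  let ?A = "Poly_Mapping.keys p \<union> Poly_Mapping.keys q"
  have "Poly_Mapping.keys (p + q) \<subseteq> ?A" by (rule Poly_Mapping.keys_add)
  then show ?thesis
    by (simp add: mpoly_eval_superset[of ?A] lookup_add sum.distrib distrib_right)
qed

lemma mpoly_eval_zero: "mpoly_eval h v 0 = 0"
  by (simp add: mpoly_eval_def)

lemma mpoly_eval_id_sum:
  "mpoly_eval id v (\<Sum>i\<in>A. f i) = (\<Sum>i\<in>A. mpoly_eval id v (f i))"
  by (induction A rule: infinite_finite_induct)
    (simp_all only: sum.infinite sum.empty sum.insert mpoly_eval_id_add mpoly_eval_zero not_False_eq_True)

lemma mpoly_eval_id_single: "mpoly_eval id v (Poly_Mapping.single m c) = c * monom_value v m"
  by (cases "c = 0") (simp_all add: mpoly_eval_def)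

lemma tensor_map_eq_forms: "tensor_map T w $ i = mpoly_eval id (($) w) (tensor_forms T i)"
  by (simp add: tensor_map_def tensor_forms_def mpoly_eval_id_sum mpoly_eval_id_single
      monom_value_index[simplified])

lemma lookup_tensor_forms:
  "Poly_Mapping.lookup (tensor_forms T i) m =
     (\<Sum>J\<in>UNIV. T $ (i, J) when (\<Sum>k\<in>UNIV. Poly_Mapping.single (J k) 1) = m)"
  by (simp add: tensor_forms_def lookup_sum lookup_single)

lemma homogeneous_tensor_forms:
  fixes T :: "('a::comm_ring_1, 'n::finite, 'd::finite) tensor"
  shows "homogeneous CARD('d) (tensor_forms T i)"
  unfolding homogeneous_def
proof
  fix m assume "m \<in> Poly_Mapping.keys (tensor_forms T i)"
  then have "Poly_Mapping.lookup (tensor_forms T i) m \<noteq> 0" by (simp add: in_keys_iff)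
  then obtain J :: "'d \<Rightarrow> 'n" where "(\<Sum>k\<in>UNIV. Poly_Mapping.single (J k) 1) = m"
    unfolding lookup_tensor_forms
    by (elim sum.not_neutral_contains_not_neutral) (auto simp: when_def split: if_splits)
  then show "mdegree m = CARD('d)"
    using mdegree_index[of UNIV J] by simp
qed

lemma tensor_resultant_eq_0_iff:
  fixes T :: "(complex, 'n::finite, 'd::finite) tensor"
  assumes "macaulay_resultant CARD('d) R"
  shows "tensor_resultant R T = 0 \<longleftrightarrow> (\<exists>w. w \<noteq> 0 \<and> tensor_map T w = 0)"
  using assms homogeneous_tensor_forms[of T]
  by (simp add: macaulay_resultant_def tensor_resultant_def has_projective_zero_def
      tensor_map_eq_forms vec_eq_iff)

lemma poly_char_poly: "poly (char_poly R T t) s = tensor_resultant R (T - s *s t)"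
proof -
  have *: "poly (Poly_Mapping.lookup (tensor_forms (const_tensor T - [:0, 1:] *s const_tensor t) i) m) s
      = Poly_Mapping.lookup (tensor_forms (T - s *s t) i) m" for i m
    by (simp add: lookup_tensor_forms poly_sum when_def const_tensor_def if_distrib[of "\<lambda>p. poly p s"]
        cong: if_cong)
  show ?thesis
    by (simp add: char_poly_def tensor_resultant_def resultant_value_def mpoly_eval_def
        monom_value_def poly_sum poly_prod case_prod_unfold *)
qed

end

theory Submission
  imports Defs
begin

text \<open>
  Let \<open>B\<close> be a basis of the span of the eigenset that consists of eigenvectors. The line
  \<open>T - s t\<close> of tensors is the diagonal of a larger family with one parameter \<open>x\<^sub>b\<close> for each
  \<open>b \<in> B\<close>: as \<open>B\<close> is linearly independent, there are tensors \<open>H\<^sub>b\<close> (the \<open>d\<close>-th power of a linear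
  form dual to \<open>b\<close>, times the vector \<open>t(b)\<close>) whose map agrees with that of \<open>t\<close> at \<open>b\<close> and vanishes
  on the rest of \<open>B\<close>. Thus \<open>r = t - \<Sum>\<^sub>b H\<^sub>b\<close> vanishes on \<open>B\<close>, and so does \<open>T - l t\<close>.
  Consider
  \<open>F(x\<^sub>0, x) = Res (T - l t - x\<^sub>0 r - \<Sum>\<^sub>b x\<^sub>b H\<^sub>b)\<close>.

  If \<open>x\<^sub>b = 0\<close>, then \<open>b\<close> is a nonzero common zero of the forms, and the resultant vanishes. A polynomial
  that vanishes on several coordinate hyperplanes is divisible by the product of these coordinates,
  so \<open>\<Prod>\<^sub>b x\<^sub>b\<close> divides \<open>F\<close>. On the diagonal, where all parameters equal \<open>s - l\<close>, the tensor is
  \<open>T - s t\<close>, so \<open>(s - l)\<close> to the power \<open>card B\<close> divides the characteristic polynomial. That polynomial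
  is nonzero, because \<open>Res t \<noteq> 0\<close> implies \<open>Res (u T + t) \<noteq> 0\<close> for some \<open>u \<noteq> 0\<close>. So \<open>card B\<close> is at most
  the order of the root \<open>l\<close>.
\<close>

section \<open>Polynomial functions\<close>

text \<open>
  Only values of polynomials matter, so a function that has some polynomial expression replaces
  the polynomial itself; the generation rules give structural induction.
\<close>

inductive polynomial_fun :: "(('v \<Rightarrow> 'a::comm_ring_1) \<Rightarrow> 'a) \<Rightarrow> bool" where
  const: "polynomial_fun (\<lambda>x. c)"
| var: "polynomial_fun (\<lambda>x. x i)"
| add: "polynomial_fun F \<Longrightarrow> polynomial_fun G \<Longrightarrow> polynomial_fun (\<lambda>x. F x + G x)"
| mult: "polynomial_fun F \<Longrightarrow> polynomial_fun G \<Longrightarrow> polynomial_fun (\<lambda>x. F x * G x)"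

lemma polynomial_fun_diff:
  assumes "polynomial_fun F" "polynomial_fun G"
  shows "polynomial_fun (\<lambda>x. F x - G x)"
  using add[OF assms(1) mult[OF const[of "-1"] assms(2)]] by simp

lemma polynomial_fun_sum:
  assumes "\<And>a. a \<in> A \<Longrightarrow> polynomial_fun (F a)"
  shows "polynomial_fun (\<lambda>x. \<Sum>a\<in>A. F a x)"
  using assms by (induction A rule: infinite_finite_induct) (auto intro: const add)

lemma polynomial_fun_prod:
  assumes "\<And>a. a \<in> A \<Longrightarrow> polynomial_fun (F a)"
  shows "polynomial_fun (\<lambda>x. \<Prod>a\<in>A. F a x)"
  using assms by (induction A rule: infinite_finite_induct) (auto intro: const mult)

lemma polynomial_fun_power:
  assumes "polynomial_fun F"
  shows "polynomial_fun (\<lambda>x. F x ^ k)"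
  using assms by (induction k) (auto intro: const mult)

lemma polynomial_fun_diagonal:
  assumes "polynomial_fun F"
  shows "\<exists>q. \<forall>s. F (\<lambda>_. s) = poly q s"
  using assms
proof (induction rule: polynomial_fun.induct)
  case (const c)
  show ?case by (rule exI[of _ "[:c:]"]) simp
next
  case (var i)
  show ?case by (rule exI[of _ "[:0, 1:]"]) simp
next
  case (add F G)
  then show ?case by (metis poly_add)
next
  case (mult F G)
  then show ?case by (metis poly_mult)
qed

text \<open>
  This is the factor theorem for the coordinate \<open>x\<^sub>i\<close>; in the product case, the Leibniz
  rule for difference quotients applies.
\<close>

lemma polynomial_fun_diff_quotient:
  assumes "polynomial_fun F"
  shows "\<exists>G. polynomial_fun G \<and> (\<forall>x. F x - F (x(i := 0)) = x i * G x)"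
  using assms
proof (induction rule: polynomial_fun.induct)
  case (const c)
  show ?case by (rule exI[of _ "\<lambda>_. 0"]) (simp add: polynomial_fun.const)
next
  case (var j)
  show ?case
    by (rule exI[of _ "\<lambda>_. if i = j then 1 else 0"]) (simp add: polynomial_fun.const)
next
  case (add F G)
  obtain F' where F': "polynomial_fun F'" "\<And>x. F x - F (x(i := 0)) = x i * F' x"
    using add.IH(1) by (elim exE conjE) simp
  obtain G' where G': "polynomial_fun G'" "\<And>x. G x - G (x(i := 0)) = x i * G' x"
    using add.IH(2) by (elim exE conjE) simp
  have "F x + G x - (F (x(i := 0)) + G (x(i := 0))) = x i * (F' x + G' x)" for x
    by (simp only: distrib_left F'(2)[symmetric] G'(2)[symmetric]) simp
  then show ?case
    by (intro exI[of _ "\<lambda>x. F' x + G' x"] conjI allI polynomial_fun.add[OF F'(1) G'(1)])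
next
  case (mult F G)
  obtain F' where F': "polynomial_fun F'" "\<And>x. F x - F (x(i := 0)) = x i * F' x"
    using mult.IH(1) by (elim exE conjE) simp
  obtain G' where G': "polynomial_fun G'" "\<And>x. G x - G (x(i := 0)) = x i * G' x"
    using mult.IH(2) by (elim exE conjE) simp
  let ?H = "\<lambda>x. F' x * G x + (F x - x i * F' x) * G' x"
  have "F x * G x - F (x(i := 0)) * G (x(i := 0)) = x i * ?H x" for x
  proof -
    have F0: "F (x(i := 0)) = F x - x i * F' x" unfolding F'(2)[symmetric] by simp
    have G0: "G (x(i := 0)) = G x - x i * G' x" unfolding G'(2)[symmetric] by simp
    show ?thesis unfolding F0 G0 by (simp add: algebra_simps)
  qed
  moreover have "polynomial_fun ?H"
    by (intro polynomial_fun.add polynomial_fun.mult polynomial_fun_diff polynomial_fun.var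
        mult.hyps F'(1) G'(1))
  ultimately show ?case by (intro exI[of _ ?H] conjI allI)
qed

text \<open>
  When a further coordinate \<open>x\<^sub>j\<close> is split off from \<open>F = (\<Prod>\<^sub>i x\<^sub>i) G\<close>, the quotient \<open>G\<close> need not be shown to
  vanish for \<open>x\<^sub>j = 0\<close>: subtracting the value of \<open>F\<close> there, which is \<open>0\<close>, replaces \<open>G\<close> by a difference.
  This avoids cancellation and works over every commutative ring.
\<close>

lemma polynomial_fun_vanishing_on_hyperplanes:
  assumes "finite I" "polynomial_fun F" "\<And>i x. i \<in> I \<Longrightarrow> x i = 0 \<Longrightarrow> F x = 0"
  shows "\<exists>G. polynomial_fun G \<and> (\<forall>x. F x = (\<Prod>i\<in>I. x i) * G x)"
  using assms(1,3)
proof (induction I rule: finite_induct)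
  case empty
  show ?case using assms(2) by auto
next
  case (insert j I)
  then obtain G where G: "polynomial_fun G" "\<And>x. F x = (\<Prod>i\<in>I. x i) * G x"
    by blast
  obtain H where H: "polynomial_fun H" "\<And>x. G x - G (x(j := 0)) = x j * H x"
    using polynomial_fun_diff_quotient[OF G(1)] by blast
  have "F x = (\<Prod>i\<in>insert j I. x i) * H x" for x
  proof -
    have "(\<Prod>i\<in>I. (x(j := 0)) i) = (\<Prod>i\<in>I. x i)"
      using insert.hyps by (intro prod.cong) auto
    moreover have "F (x(j := 0)) = 0" by (rule insert.prems[of j]) auto
    ultimately have "F x = (\<Prod>i\<in>I. x i) * (G x - G (x(j := 0)))"
      using G(2)[of x] G(2)[of "x(j := 0)"] by (simp add: right_diff_distrib)
    then show ?thesis using insert.hyps H(2)[of x] by (simp add: algebra_simps)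
  qed
  with H(1) show ?case by blast
qed


section \<open>Tensors and their resultants\<close>

lemma tensor_map_add: "tensor_map (S + T) w = tensor_map S w + tensor_map T w"
  by (simp add: tensor_map_def vec_eq_iff distrib_right sum.distrib)

lemma tensor_map_scale: "tensor_map (c *s T) w = c *s tensor_map T w"
  by (simp add: tensor_map_def vec_eq_iff sum_distrib_left mult.assoc)

lemma tensor_map_diff: "tensor_map (S - T) w = tensor_map S w - tensor_map T w"
  by (simp add: tensor_map_def vec_eq_iff left_diff_distrib sum_subtractf)

lemma tensor_map_sum: "tensor_map (\<Sum>a\<in>A. S a) w = (\<Sum>a\<in>A. tensor_map (S a) w)"
  by (induction A rule: infinite_finite_induct)
    (simp_all add: tensor_map_add, simp_all add: tensor_map_def vec_eq_iff)

lemma polynomial_fun_tensor_resultant: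
  assumes "\<And>I. polynomial_fun (\<lambda>x. S x $ I)"
  shows "polynomial_fun (\<lambda>x. tensor_resultant R (S x))"
proof -
  have entry: "polynomial_fun (\<lambda>x. S x $ I when P)" for I P
    by (cases P) (simp_all add: assms const)
  show ?thesis
    unfolding tensor_resultant_def resultant_value_def mpoly_eval_def monom_value_def
      case_prod_unfold lookup_tensor_forms
    by (intro polynomial_fun_sum mult const polynomial_fun_prod polynomial_fun_power entry)
qed

text \<open>The tensor of the polynomial map \<open>w \<mapsto> (c \<bullet> w)\<^sup>d v\<close>.\<close>

definition power_tensor :: "'a ^ 'n \<Rightarrow> 'a ^ 'n \<Rightarrow> ('a::comm_ring_1, 'n::finite, 'd::finite) tensor" where
  "power_tensor c v = (\<chi> I. v $ fst I * (\<Prod>k\<in>UNIV. c $ snd I k))"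

lemma tensor_map_power_tensor:
  "tensor_map (power_tensor c v :: ('a::comm_ring_1, 'n::finite, 'd::finite) tensor) w
    = (\<Sum>j\<in>UNIV. c $ j * w $ j) ^ CARD('d) *s v"
proof -
  have "(\<Sum>j\<in>UNIV. c $ j * w $ j) ^ CARD('d) = (\<Prod>k\<in>(UNIV :: 'd set). \<Sum>j\<in>UNIV. c $ j * w $ j)"
    by simp
  also have "\<dots> = (\<Sum>J\<in>UNIV. \<Prod>k\<in>(UNIV :: 'd set). c $ J k * w $ J k)"
    by (subst prod_sum_PiE) (simp_all add: PiE_UNIV_domain)
  finally show ?thesis
    by (simp add: tensor_map_def power_tensor_def vec_eq_iff prod.distrib sum_distrib_left
        sum_distrib_right mult_ac)
qed

lemma independent_dual_vector:
  fixes B :: "('a::field ^ 'n::finite) set"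
  assumes "vec.independent B"
  shows "\<exists>c. \<forall>w\<in>B. (\<Sum>j\<in>UNIV. c $ j * w $ j) = (if w = b then 1 else 0)"
proof -
  \<comment> \<open>The dual functional is a component of an endomorphism; as all entries of \<open>e\<close> are \<open>1\<close>,
    every component serves.\<close>
  define e :: "'a ^ 'n" where "e = (\<chi> i. 1)"
  obtain g where g: "Vector_Spaces.linear (*s) (*s) g"
    and gB: "\<And>w. w \<in> B \<Longrightarrow> g w = (if w = b then e else 0)"
    using vec.linear_independent_extend[OF assms, of "\<lambda>w. if w = b then e else 0"] by blast
  define c where "c = matrix g $ (SOME i. True)"
  have "(\<Sum>j\<in>UNIV. c $ j * w $ j) = g w $ (SOME i. True)" for w
    using matrix_works[OF g, of w] by (simp add: c_def matrix_vector_mult_def vec_eq_iff)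
  then show ?thesis using gB by (intro exI[of _ c]) (simp add: e_def)
qed


section \<open>The characteristic polynomial\<close>

text \<open>
  The parameter \<open>u = 0\<close> in \<open>u T + t\<close> corresponds to \<open>s = \<infinity>\<close> in \<open>T - s t\<close>. As a polynomial that is nonzero
  at \<open>0\<close> is nonzero at another point too, some finite value of \<open>s\<close> suffices.
\<close>

lemma char_poly_nonzero:
  fixes R :: "('n::finite) coeff_poly" and T t :: "(complex, 'n, 'd::finite) tensor"
  assumes R: "macaulay_resultant CARD('d) R" and t: "tensor_resultant R t \<noteq> 0"
  shows "char_poly R T t \<noteq> 0"
proof -
  have "polynomial_fun (\<lambda>x. tensor_resultant R (x () *s T + t))"
    by (intro polynomial_fun_tensor_resultant) (simp, intro add mult var const)
  then obtain q where q: "\<And>u. tensor_resultant R (u *s T + t) = poly q u"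
    using polynomial_fun_diagonal by blast
  have "q \<noteq> 0" using q[of 0] t by auto
  then have "finite (insert 0 {u. poly q u = 0})" by (simp add: poly_roots_finite)
  then obtain u where u: "u \<noteq> 0" "poly q u \<noteq> 0"
    using ex_new_if_finite[OF infinite_UNIV_char_0] by blast
  have "u *s (T - (- 1 / u) *s t) = u *s T + t"
    using u(1) by (simp add: vec_eq_iff algebra_simps)
  then have "tensor_map (u *s T + t) w = u *s tensor_map (T - (- 1 / u) *s t) w" for w
    by (metis tensor_map_scale)
  then have "tensor_resultant R (T - (- 1 / u) *s t) \<noteq> 0"
    using u(2) unfolding q[symmetric] tensor_resultant_eq_0_iff[OF R]
    by (metis vec.scale_zero_right)
  then show ?thesis using poly_char_poly[of R T t "- 1 / u"] by auto
qed

text \<open>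
  The independent eigenvectors \<open>b\<close> have separate parameters \<open>x (Some b)\<close>, and \<open>x None\<close> scales the
  part of \<open>t\<close> that vanishes at all of them.
\<close>

lemma char_poly_independent_eigenvectors:
  fixes R :: "('n::finite) coeff_poly" and T t :: "(complex, 'n, 'd::finite) tensor"
  assumes R: "macaulay_resultant CARD('d) R"
    and B: "B \<subseteq> eigenset T t l" "vec.independent B"
  shows "[:- l, 1:] ^ card B dvd char_poly R T t"
proof -
  have "finite B" using B(2) by (rule vec.finiteI_independent)
  obtain c where c: "\<And>b w. w \<in> B \<Longrightarrow> (\<Sum>j\<in>UNIV. c b $ j * w $ j) = (if w = b then 1 else 0)"
    using independent_dual_vector[OF B(2)] by metis
  define H :: "complex ^ 'n \<Rightarrow> (complex, 'n, 'd) tensor"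
    where "H b = power_tensor (c b) (tensor_map t b)" for b
  have H: "tensor_map (H b) w = (if w = b then tensor_map t w else 0)" if "w \<in> B" for b w
    using that by (simp add: H_def tensor_map_power_tensor c zero_power)
  define r where "r = t - (\<Sum>b\<in>B. H b)"
  have r: "tensor_map r w = 0" if "w \<in> B" for w
    using that \<open>finite B\<close> by (simp add: r_def tensor_map_diff tensor_map_sum H)
  define S :: "((complex ^ 'n) option \<Rightarrow> complex) \<Rightarrow> (complex, 'n, 'd) tensor"
    where "S x = T - l *s t - x None *s r - (\<Sum>b\<in>B. x (Some b) *s H b)" for x
  have S: "tensor_map (S x) w = - (x (Some w) *s tensor_map t w)" if "w \<in> B" for x w
  proof -
    have "tensor_map (T - l *s t) w = 0"
      using that B(1) by (auto simp: eigenset_def)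
    moreover have "(\<Sum>b\<in>B. x (Some b) *s tensor_map (H b) w) = x (Some w) *s tensor_map t w"
    proof -
      have "(\<Sum>b\<in>B. x (Some b) *s tensor_map (H b) w)
          = (\<Sum>b\<in>B. if w = b then x (Some w) *s tensor_map t w else 0)"
        using that by (intro sum.cong) (auto simp: H)
      then show ?thesis using that \<open>finite B\<close> by simp
    qed
    ultimately show ?thesis
      using that by (simp add: S_def tensor_map_diff[of _ "sum _ _"] tensor_map_diff[of _ "_ *s r"]
          tensor_map_sum tensor_map_scale r)
  qed
  have poly_S: "polynomial_fun (\<lambda>x. tensor_resultant R (S x))"
    unfolding S_def
    by (intro polynomial_fun_tensor_resultant)
      (simp, intro polynomial_fun_diff polynomial_fun_sum mult var const)
  have vanish: "tensor_resultant R (S x) = 0" if "i \<in> Some ` B" "x i = 0" for i x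
  proof -
    from that obtain b where b: "b \<in> B" "x (Some b) = 0" by blast
    moreover have "b \<noteq> 0" using b(1) B(2) vec.dependent_zero by blast
    ultimately show ?thesis using S[of b x] by (auto simp: tensor_resultant_eq_0_iff[OF R])
  qed
  have "\<exists>G. polynomial_fun G \<and> (\<forall>x. tensor_resultant R (S x) = (\<Prod>i\<in>Some ` B. x i) * G x)"
    using \<open>finite B\<close> poly_S vanish
    by (intro polynomial_fun_vanishing_on_hyperplanes) simp_all
  then obtain G where G: "polynomial_fun G"
      "\<And>x. tensor_resultant R (S x) = (\<Prod>i\<in>Some ` B. x i) * G x"
    by (elim exE conjE) simp
  obtain q where q: "\<And>s. G (\<lambda>_. s) = poly q s"
    using polynomial_fun_diagonal[OF G(1)] by blast
  have diagonal: "S (\<lambda>_. s - l) = T - s *s t" for s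
    by (simp add: S_def r_def vec.scale_sum_right[symmetric] vec.scale_right_diff_distrib
        vec.scale_left_diff_distrib sum_subtractf)
  have "poly (char_poly R T t) s = poly ([:- l, 1:] ^ card B * pcompose q [:- l, 1:]) s" for s
    using G(2)[of "\<lambda>_. s - l"] q[of "s - l"] diagonal[of s]
    by (simp add: poly_char_poly poly_pcompose card_image)
  then have "char_poly R T t = [:- l, 1:] ^ card B * pcompose q [:- l, 1:]"
    by (intro poly_eq_poly_eq_iff[THEN iffD1] ext)
  then show ?thesis by simp
qed

theorem corollary1p8:
  fixes R :: "('n::finite) coeff_poly"
    and T t :: "(complex, 'n, 'd::finite) tensor"
    and l :: complex
  assumes "CARD('n) \<ge> 2"
    and "macaulay_resultant CARD('d) R"
    and "tensor_resultant R t \<noteq> 0"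
  shows "alg_multiplicity R T t l \<ge> span_multiplicity T t l"
proof -
  obtain B where B: "B \<subseteq> eigenset T t l" "vec.independent B"
      "card B = vec.dim (eigenset T t l)"
    using vec.basis_exists by metis
  have "span_multiplicity T t l = card B"
    by (simp add: span_multiplicity_def B(3))
  moreover have "card B \<le> order l (char_poly R T t)"
    using char_poly_independent_eigenvectors[OF assms(2) B(1,2)]
      char_poly_nonzero[OF assms(2,3), of T]
    by (simp add: order_divides)
  ultimately show ?thesis by (simp add: alg_multiplicity_def)
qed

end
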